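(* For any $(a,b),(p_1,q_1),(p_2,q_2)\in\mathbb{R}_+^2$ and $\alpha,\beta>0$ with $\alpha+\beta=1$, the following double inequality holds: $$1\le \frac{S_{\alpha p_1+\beta p_2,\ \alpha q_1+\beta q_2}(a,b)}{S_{p_1,q_1}(a,b)^{\alpha}\,S_{p_2,q_2}(a,b)^{\beta}}\le \exp\left(\frac{\alpha}{L(p_1,q_1)}+\frac{\beta}{L(p_2,q_2)}-\frac{1}{L(\alpha p_1+\beta p_2,\ \alpha q_1+\beta q_2)}\right).$$
   Context: Notation: $\mathbb{R}_+=(0,\infty)$. $L$ is the logarithmic mean: $L(x,y)=\frac{x-y}{\ln x-\ln y}$ for $x,y>0$, $x\ne y$, and $L(x,x)=x$. Stolarsky means (for positive parameters $p,q$): for $a,b>0$ with $a\neq b$, $S_{p,q}(a,b)=\left(\frac{q(a^p-b^p)}{p(a^q-b^q)}\right)^{1/(p-q)}$ if $p\neq q$, and $S_{p,p}(a,b)=\exp\left(\frac{a^p\ln a-b^p\ln b}{a^p-b^p}-\frac1p\right)$; also $S_{p,q}(a,a)=a$. *)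

theory Defs
  imports Complex_Main
begin

(* Both means are intended for positive arguments and parameters only. *)

definition logarithmic_mean :: "real \<Rightarrow> real \<Rightarrow> real" where
  "logarithmic_mean x y = (if x = y then x else (x - y) / (ln x - ln y))"

definition stolarsky_mean :: "real \<Rightarrow> real \<Rightarrow> real \<Rightarrow> real \<Rightarrow> real" where
  "stolarsky_mean p q a b =
    (if a = b then a
     else if p = q then exp ((a powr p * ln a - b powr p * ln b) / (a powr p - b powr p) - 1 / p)
     else ((q * (a powr p - b powr p)) / (p * (a powr q - b powr q))) powr (1 / (p - q)))"

end

theory Submission
  imports Defs "HOL-Analysis.Analysis"
begin

text \<open>
  Let \<open>F t = ln ((a powr t - b powr t) / t)\<close> for \<open>a > b\<close>. The logarithm of the Stolarsky mean is the
  divided difference of \<open>F\<close> at \<open>p\<close> and \<open>q\<close>, and the reciprocal of the logarithmic mean is the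
  divided difference of \<open>ln\<close>. A divided difference is the average of the derivative over
  the segment, so it is jointly convex in \<open>(p, q)\<close> if the derivative is convex. Writing
  \<open>h = (ln a - ln b) / 2\<close>, the derivative of \<open>F + ln\<close> is a constant plus \<open>h * coth (h * t)\<close>, which
  is convex, and the derivative of \<open>F\<close> is a constant plus \<open>h * coth (h * t) - 1 / t\<close>, which is
  concave because \<open>x ^ 3 * cosh x \<le> sinh x ^ 3\<close>. These two facts give the upper and the lower bound.
\<close>

section \<open>Divided differences as averages of a derivative\<close>

definition divided_difference :: "(real \<Rightarrow> real) \<Rightarrow> (real \<Rightarrow> real) \<Rightarrow> real \<Rightarrow> real \<Rightarrow> real" where
  "divided_difference F f p q = (if p = q then f p else (F p - F q) / (p - q))"

lemma divided_difference_add: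
  "divided_difference (\<lambda>t. F t + G t) (\<lambda>t. f t + g t) p q
    = divided_difference F f p q + divided_difference G g p q"
  by (simp add: divided_difference_def add_divide_distrib diff_divide_distrib)

lemma divided_difference_minus:
  "divided_difference (\<lambda>t. - F t) (\<lambda>t. - f t) p q = - divided_difference F f p q"
  by (simp add: divided_difference_def divide_simps)

lemma convex_combination_pos:
  fixes x y s :: real
  assumes "x > 0" "y > 0" "s \<in> {0..1}"
  shows "(1 - s) * y + s * x > 0"
  using assms by (cases "s = 0") (auto intro!: add_nonneg_pos)

text \<open>Off the diagonal this is the fundamental theorem of calculus along the segment from
  \<open>q\<close> to \<open>p\<close>: the chain rule produces the factor \<open>p - q\<close>,
  which the denominator cancels. On the diagonal the integrand is constant.\<close>

lemma has_integral_divided_difference: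
  assumes F: "\<And>t. t > 0 \<Longrightarrow> (F has_real_derivative f t) (at t)" and pq: "p > 0" "q > 0"
  shows "((\<lambda>s. f ((1 - s) * q + s * p)) has_integral divided_difference F f p q) {0..1}"
proof (cases "p = q")
  case True
  have "((\<lambda>s::real. f p) has_integral f p) {0..1}"
    using has_integral_const_real[of "f p" 0 1] by simp
  with True show ?thesis
    by (simp add: divided_difference_def algebra_simps)
next
  case False
  have "((\<lambda>s. F ((1 - s) * q + s * p) / (p - q)) has_vector_derivative f ((1 - s) * q + s * p))
          (at s within {0..1})" if "s \<in> {0..1}" for s
  proof -
    have pos: "(1 - s) * q + s * p > 0"
      using pq that by (rule convex_combination_pos)
    have "((\<lambda>s. F ((1 - s) * q + s * p) / (p - q)) has_real_derivative
            f ((1 - s) * q + s * p) * (p - q) / (p - q)) (at s within {0..1})"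
      by (rule DERIV_cdivide, rule DERIV_chain2[where f = F and g = "\<lambda>s. (1 - s) * q + s * p", OF F[OF pos]])
        (auto intro!: derivative_eq_intros)
    with False show ?thesis
      by (simp add: has_real_derivative_iff_has_vector_derivative)
  qed
  from fundamental_theorem_of_calculus[OF _ this] False show ?thesis
    by (simp add: divided_difference_def diff_divide_distrib)
qed

text \<open>For fixed \<open>s\<close> the point \<open>(1 - s) * q + s * p\<close> is linear in
  \<open>(p, q)\<close>, so convexity of \<open>f\<close> compares the integrands pointwise, and
  integrating over \<open>s\<close> keeps the inequality.\<close>

lemma divided_difference_convex:
  assumes F: "\<And>t. t > 0 \<Longrightarrow> (F has_real_derivative f t) (at t)"
    and f: "convex_on {0<..} f"
    and pos: "p1 > 0" "q1 > 0" "p2 > 0" "q2 > 0" "\<alpha> > 0" "\<beta> > 0" and sum: "\<alpha> + \<beta> = 1"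
  shows "divided_difference F f (\<alpha> * p1 + \<beta> * p2) (\<alpha> * q1 + \<beta> * q2)
    \<le> \<alpha> * divided_difference F f p1 q1 + \<beta> * divided_difference F f p2 q2"
proof (rule has_integral_le)
  let ?p = "\<alpha> * p1 + \<beta> * p2" and ?q = "\<alpha> * q1 + \<beta> * q2"
  show "((\<lambda>s. f ((1 - s) * ?q + s * ?p)) has_integral divided_difference F f ?p ?q) {0..1}"
    using pos by (intro has_integral_divided_difference F add_pos_pos mult_pos_pos) auto
  show "((\<lambda>s. \<alpha> * f ((1 - s) * q1 + s * p1) + \<beta> * f ((1 - s) * q2 + s * p2)) has_integral
      \<alpha> * divided_difference F f p1 q1 + \<beta> * divided_difference F f p2 q2) {0..1}"
    using pos by (intro has_integral_add has_integral_mult_right has_integral_divided_difference F) auto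
  fix s :: real assume s: "s \<in> {0..1}"
  have gt: "(1 - s) * y + s * x > 0" if "x > 0" "y > 0" for x y
    using that s by (rule convex_combination_pos)
  have "(1 - s) * ?q + s * ?p
      = \<alpha> * ((1 - s) * q1 + s * p1) + \<beta> * ((1 - s) * q2 + s * p2)"
    by (simp add: algebra_simps)
  moreover have "f (\<alpha> * ((1 - s) * q1 + s * p1) + \<beta> * ((1 - s) * q2 + s * p2))
      \<le> \<alpha> * f ((1 - s) * q1 + s * p1) + \<beta> * f ((1 - s) * q2 + s * p2)"
    using f gt pos sum unfolding convex_on_def by auto
  ultimately show "f ((1 - s) * ?q + s * ?p)
      \<le> \<alpha> * f ((1 - s) * q1 + s * p1) + \<beta> * f ((1 - s) * q2 + s * p2)"
    by simp
qed

section \<open>Hyperbolic inequality and convexity involving coth\<close>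

lemma cube_times_cosh_le_sinh_cube:
  fixes x :: real
  assumes "x \<ge> 0"
  shows "x ^ 3 * cosh x \<le> sinh x ^ 3"
proof -
  \<comment> \<open>\<open>u\<close> is the \<open>-1/3\<close> power of \<open>cosh\<close>; the inequality says that \<open>sinh x * u x - x\<close>, which is
    increasing, is nonnegative.\<close>
  define u where "u = (\<lambda>x::real. exp (- ln (cosh x) / 3))"
  have u_pos: "u x > 0" for x
    by (simp add: u_def)
  have u_cube: "u x ^ 3 * cosh x = 1" for x
    by (simp add: u_def flip: exp_of_nat_mult) (simp add: exp_minus)
  have deriv: "((\<lambda>x. sinh x * u x - x) has_real_derivative
      cosh x * u x + sinh x * (- u x * (sinh x / cosh x) / 3) - 1) (at x)" for x
    unfolding u_def by (auto intro!: derivative_eq_intros simp: field_simps)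
  have deriv_nonneg: "cosh x * u x + sinh x * (- u x * (sinh x / cosh x) / 3) - 1 \<ge> 0" for x
  proof -
    have c: "cosh x = 1 / u x ^ 3"
      using u_cube[of x] u_pos[of x] by (simp add: field_simps)
    have "sinh x * (- u x * (sinh x / cosh x) / 3) = - (cosh x ^ 2 - 1) * u x / cosh x / 3"
      unfolding cosh_square_eq by (simp add: power2_eq_square)
    also have "\<dots> = - (1 - u x ^ 6) / (3 * u x ^ 2)"
      unfolding c using u_pos[of x] by (simp add: field_simps power2_eq_square eval_nat_numeral)
    \<comment> \<open>In terms of \<open>v = u x ^ 2\<close> the numerator is
      \<open>v ^ 3 - 3 * v + 2\<close>, which has a double root at \<open>v = 1\<close>; hence the
      square.\<close>
    finally have "cosh x * u x + sinh x * (- u x * (sinh x / cosh x) / 3) - 1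
        = (1 - u x ^ 2) ^ 2 * (2 + u x ^ 2) / (3 * u x ^ 2)"
      unfolding c using u_pos[of x] by (simp add: field_simps eval_nat_numeral)
    then show ?thesis
      by simp
  qed
  have "sinh 0 * u 0 - 0 \<le> sinh x * u x - x"
    using assms deriv deriv_nonneg by (intro DERIV_nonneg_imp_nondecreasing[OF assms]) blast
  then have "x ^ 3 \<le> (sinh x * u x) ^ 3"
    using assms by (intro power_mono) auto
  then have "x ^ 3 * cosh x \<le> sinh x ^ 3 * (u x ^ 3 * cosh x)"
    by (simp add: power_mult_distrib mult_right_mono)
  then show ?thesis
    by (simp add: u_cube)
qed

lemma has_derivative_coth:
  fixes h t :: real
  assumes "h * t > 0"
  shows "((\<lambda>t. h * cosh (h * t) / sinh (h * t)) has_real_derivative - (h ^ 2) / sinh (h * t) ^ 2) (at t)"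
proof -
  have "sinh (h * t) \<noteq> 0"
    using assms by auto
  moreover have "h * (h * cosh (h * t) ^ 2) = h ^ 2 + h ^ 2 * sinh (h * t) ^ 2"
    unfolding cosh_square_eq by (simp add: algebra_simps power2_eq_square)
  ultimately show ?thesis
    by (auto intro!: derivative_eq_intros simp: field_simps power2_eq_square)
qed

lemma has_second_derivative_coth:
  fixes h t :: real
  assumes "h * t > 0"
  shows "((\<lambda>t. - (h ^ 2) / sinh (h * t) ^ 2) has_real_derivative
    2 * h ^ 3 * cosh (h * t) / sinh (h * t) ^ 3) (at t)"
proof -
  have "sinh (h * t) \<noteq> 0"
    using assms by auto
  then show ?thesis
    by (auto intro!: derivative_eq_intros simp: field_simps eval_nat_numeral)
qed

text \<open>The coth formula for the derivative holds only for \<open>t > 0\<close>, so convexity is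
  carried over along an equality on \<open>S\<close>; convexity of \<open>S\<close> keeps the
  combined points inside it.\<close>

lemma convex_on_eq:
  assumes f: "convex_on S f" and eq: "\<And>x. x \<in> S \<Longrightarrow> f x = g x"
  shows "convex_on S g"
  using f convexD[OF convex_on_imp_convex[OF f]] by (simp add: convex_on_def eq)

lemma convex_on_coth:
  fixes h :: real
  assumes "h > 0"
  shows "convex_on {0<..} (\<lambda>t. h * cosh (h * t) / sinh (h * t))"
proof (rule f''_ge0_imp_convex)
  fix t :: real assume t: "t \<in> {0<..}"
  with assms show "((\<lambda>t. h * cosh (h * t) / sinh (h * t)) has_real_derivative
      - (h ^ 2) / sinh (h * t) ^ 2) (at t)"
    by (intro has_derivative_coth) simp
  from t assms show "((\<lambda>t. - (h ^ 2) / sinh (h * t) ^ 2) has_real_derivative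
      2 * h ^ 3 * cosh (h * t) / sinh (h * t) ^ 3) (at t)"
    by (intro has_second_derivative_coth) simp
  from t assms show "0 \<le> 2 * h ^ 3 * cosh (h * t) / sinh (h * t) ^ 3"
    by simp
qed simp

text \<open>Up to a constant this is the negated derivative of \<open>F\<close>, put in convex form
  to suit \<open>divided_difference_convex\<close>. Once denominators are cleared, the sign of the
  second derivative is the cube inequality at \<open>x = h * t\<close>.\<close>

lemma convex_on_inverse_minus_coth:
  fixes h :: real
  assumes h: "h > 0"
  shows "convex_on {0<..} (\<lambda>t. 1 / t - h * cosh (h * t) / sinh (h * t))"
proof (rule f''_ge0_imp_convex)
  fix t :: real assume t: "t \<in> {0<..}"
  with h have ht: "h * t > 0"
    by simp
  have "((\<lambda>t. 1 / t) has_real_derivative - 1 / t ^ 2) (at t)"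
    using t by (auto intro!: derivative_eq_intros simp: power2_eq_square)
  from DERIV_diff[OF this has_derivative_coth[OF ht]]
  show "((\<lambda>t. 1 / t - h * cosh (h * t) / sinh (h * t)) has_real_derivative
      - 1 / t ^ 2 - - (h ^ 2) / sinh (h * t) ^ 2) (at t)" .
  have "((\<lambda>t. - 1 / t ^ 2) has_real_derivative 2 / t ^ 3) (at t)"
    using t by (auto intro!: derivative_eq_intros simp: field_simps eval_nat_numeral)
  from DERIV_diff[OF this has_second_derivative_coth[OF ht]]
  show "((\<lambda>t. - 1 / t ^ 2 - - (h ^ 2) / sinh (h * t) ^ 2) has_real_derivative
      2 / t ^ 3 - 2 * h ^ 3 * cosh (h * t) / sinh (h * t) ^ 3) (at t)" .
  have "(h * t) ^ 3 * cosh (h * t) \<le> sinh (h * t) ^ 3"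
    using ht by (intro cube_times_cosh_le_sinh_cube) simp
  then show "0 \<le> 2 / t ^ 3 - 2 * h ^ 3 * cosh (h * t) / sinh (h * t) ^ 3"
    using t ht by (simp add: divide_simps power_mult_distrib mult_ac)
qed simp

section \<open>The Stolarsky mean in terms of divided differences\<close>

lemma stolarsky_mean_commute: "stolarsky_mean p q a b = stolarsky_mean p q b a"
proof -
  have "(a powr r * ln a - b powr r * ln b) / (a powr r - b powr r)
      = (b powr r * ln b - a powr r * ln a) / (b powr r - a powr r)" for r
    by (metis minus_diff_eq minus_divide_divide)
  moreover have "(q * (a powr p - b powr p)) / (p * (a powr q - b powr q))
      = (q * (b powr p - a powr p)) / (p * (b powr q - a powr q))"
    by (metis minus_diff_eq minus_divide_divide mult_minus_right)
  ultimately show ?thesis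
    by (simp add: stolarsky_mean_def)
qed

lemma has_derivative_ln_powr_diff:
  fixes a b t :: real
  assumes "a > b" "b > 0" "t > 0"
  shows "((\<lambda>t. ln (a powr t - b powr t)) has_real_derivative
    (a powr t * ln a - b powr t * ln b) / (a powr t - b powr t)) (at t)"
proof -
  have "a powr t > b powr t"
    using assms by (simp add: powr_less_mono2)
  with assms show ?thesis
    by (auto intro!: derivative_eq_intros simp: field_simps)
qed

text \<open>Centring \<open>ln a\<close> and \<open>ln b\<close> at their midpoint \<open>c\<close>
  makes \<open>exp (c * t)\<close> a common factor of both powers; it cancels and leaves the
  hyperbolic functions of \<open>h * t\<close>.\<close>

lemma deriv_ln_powr_diff_eq_coth:
  fixes a b t :: real
  assumes ab: "a > b" "b > 0" and t: "t > 0"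
  defines "h \<equiv> (ln a - ln b) / 2"
  shows "(a powr t * ln a - b powr t * ln b) / (a powr t - b powr t)
    = (ln a + ln b) / 2 + h * cosh (h * t) / sinh (h * t)"
proof -
  define c where "c = (ln a + ln b) / 2"
  have ln: "ln a = c + h" "ln b = c - h"
    by (simp_all add: c_def h_def field_simps)
  have h: "h > 0"
    using ab by (simp add: h_def)
  have a: "a powr t = exp (c * t) * (cosh (h * t) + sinh (h * t))"
    using ab by (simp add: powr_def ln cosh_plus_sinh algebra_simps exp_add)
  have b: "b powr t = exp (c * t) * (cosh (h * t) - sinh (h * t))"
    using ab by (simp add: powr_def ln cosh_minus_sinh algebra_simps flip: exp_add)
  have "sinh (h * t) \<noteq> 0"
    using h t by simp
  moreover have "a powr t * ln a - b powr t * ln b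
      = exp (c * t) * (2 * (c * sinh (h * t) + h * cosh (h * t)))"
    unfolding a b ln by (simp add: algebra_simps)
  moreover have "a powr t - b powr t = exp (c * t) * (2 * sinh (h * t))"
    unfolding a b by (simp add: algebra_simps)
  ultimately show ?thesis
    by (simp add: c_def[symmetric] field_simps)
qed

lemma stolarsky_mean_eq_exp_divided_difference:
  fixes a b p q :: real
  assumes ab: "a > b" "b > 0" and pq: "p > 0" "q > 0"
  shows "stolarsky_mean p q a b = exp (divided_difference
    (\<lambda>t. ln (a powr t - b powr t) - ln t)
    (\<lambda>t. (a powr t * ln a - b powr t * ln b) / (a powr t - b powr t) - 1 / t) p q)"
proof -
  have powr: "a powr p > b powr p" "a powr q > b powr q"
    using assms by (simp_all add: powr_less_mono2)
  then have "ln ((q * (a powr p - b powr p)) / (p * (a powr q - b powr q)))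
      = (ln (a powr p - b powr p) - ln p) - (ln (a powr q - b powr q) - ln q)"
    and "(q * (a powr p - b powr p)) / (p * (a powr q - b powr q)) > 0"
    using pq by (simp_all add: ln_mult ln_div)
  with ab pq powr show ?thesis
    \<comment> \<open>The pattern restricts unfolding to the outer power, whose base is a quotient;
      \<open>a powr p\<close> and the like stay folded.\<close>
    by (simp add: stolarsky_mean_def divided_difference_def powr_def[of "_ / _"])
qed

lemma inverse_logarithmic_mean:
  "1 / logarithmic_mean x y = divided_difference ln (\<lambda>t. 1 / t) x y"
  by (simp add: logarithmic_mean_def divided_difference_def)

theorem corollary4p1:
  fixes a b p1 q1 p2 q2 \<alpha> \<beta> :: real
  assumes "a > 0" and "b > 0"
    and "p1 > 0" and "q1 > 0" and "p2 > 0" and "q2 > 0"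
    and "\<alpha> > 0" and "\<beta> > 0" and "\<alpha> + \<beta> = 1"
  shows "1 \<le> stolarsky_mean (\<alpha> * p1 + \<beta> * p2) (\<alpha> * q1 + \<beta> * q2) a b
           / (stolarsky_mean p1 q1 a b powr \<alpha> * stolarsky_mean p2 q2 a b powr \<beta>)
    \<and> stolarsky_mean (\<alpha> * p1 + \<beta> * p2) (\<alpha> * q1 + \<beta> * q2) a b
           / (stolarsky_mean p1 q1 a b powr \<alpha> * stolarsky_mean p2 q2 a b powr \<beta>)
       \<le> exp (\<alpha> / logarithmic_mean p1 q1 + \<beta> / logarithmic_mean p2 q2
              - 1 / logarithmic_mean (\<alpha> * p1 + \<beta> * p2) (\<alpha> * q1 + \<beta> * q2))"
    (is "?P a b")
proof -
  let ?p = "\<alpha> * p1 + \<beta> * p2" and ?q = "\<alpha> * q1 + \<beta> * q2"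
  have pos: "?p > 0" "?q > 0"
    using assms by (simp_all add: add_pos_pos)
  note convex = divided_difference_convex[OF _ _ assms(3-9)]
  let ?D = "divided_difference ln (\<lambda>t. 1 / t)"
  have L: "\<alpha> / logarithmic_mean p1 q1 + \<beta> / logarithmic_mean p2 q2 - 1 / logarithmic_mean ?p ?q
      = \<alpha> * ?D p1 q1 + \<beta> * ?D p2 q2 - ?D ?p ?q"
    by (simp flip: inverse_logarithmic_mean)
  have ordered: "?P a b" if ab: "a > b" "b > 0" for a b
  proof -
    \<comment> \<open>\<open>G\<close> is \<open>F + ln\<close> in the notation of the overview, so
      that \<open>?S\<close> below belongs to \<open>F\<close> itself.\<close>
    define G where "G = (\<lambda>t. ln (a powr t - b powr t))"
    define g where "g = (\<lambda>t. (a powr t * ln a - b powr t * ln b) / (a powr t - b powr t))"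
    define c where "c = (ln a + ln b) / 2"
    define h where "h = (ln a - ln b) / 2"
    have h: "h > 0"
      using ab by (simp add: h_def)
    let ?S = "divided_difference (\<lambda>t. G t - ln t) (\<lambda>t. g t - 1 / t)"
    have G: "(G has_real_derivative g t) (at t)" if "t > 0" for t
      unfolding G_def g_def using ab that by (rule has_derivative_ln_powr_diff)
    have g: "g t = c + h * cosh (h * t) / sinh (h * t)" if "t > 0" for t
      unfolding g_def c_def h_def using ab that by (rule deriv_ln_powr_diff_eq_coth)
    have const: "convex_on {0<..} (\<lambda>_::real. k)" for k :: real
      by (simp add: convex_on_def flip: distrib_right)
    have g_convex: "convex_on {0<..} g"
      using convex_on_add[OF const[of c] convex_on_coth[OF h]]
      by (rule convex_on_eq) (simp add: g)
    have minus_convex: "convex_on {0<..} (\<lambda>t. - (g t - 1 / t))"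
      using convex_on_add[OF const[of "- c"] convex_on_inverse_minus_coth[OF h]]
      by (rule convex_on_eq) (simp add: g)
    \<comment> \<open>Lower bound: joint convexity for \<open>- F\<close>, from which the sign is
      then pulled out.\<close>
    have "divided_difference (\<lambda>t. - (G t - ln t)) (\<lambda>t. - (g t - 1 / t)) ?p ?q
      \<le> \<alpha> * divided_difference (\<lambda>t. - (G t - ln t)) (\<lambda>t. - (g t - 1 / t)) p1 q1
        + \<beta> * divided_difference (\<lambda>t. - (G t - ln t)) (\<lambda>t. - (g t - 1 / t)) p2 q2"
      by (rule convex[OF _ minus_convex]) (auto intro!: derivative_eq_intros G)
    then have lower: "\<alpha> * ?S p1 q1 + \<beta> * ?S p2 q2 \<le> ?S ?p ?q"
      unfolding divided_difference_minus by linarith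
    have split: "divided_difference G g x y = ?S x y + ?D x y" for x y
      by (simp flip: divided_difference_add)
    \<comment> \<open>Upper bound: joint convexity for \<open>F + ln\<close>, with the
      \<open>ln\<close> part then split off as \<open>?D\<close>.\<close>
    have "divided_difference G g ?p ?q
        \<le> \<alpha> * divided_difference G g p1 q1 + \<beta> * divided_difference G g p2 q2"
      by (rule convex[OF G g_convex])
    then have upper: "?S ?p ?q + ?D ?p ?q
        \<le> \<alpha> * ?S p1 q1 + \<beta> * ?S p2 q2 + (\<alpha> * ?D p1 q1 + \<beta> * ?D p2 q2)"
      unfolding split by (simp add: algebra_simps)
    have S: "stolarsky_mean x y a b = exp (?S x y)" if "x > 0" "y > 0" for x y
      unfolding G_def g_def using ab that by (rule stolarsky_mean_eq_exp_divided_difference)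
    have "stolarsky_mean ?p ?q a b
        / (stolarsky_mean p1 q1 a b powr \<alpha> * stolarsky_mean p2 q2 a b powr \<beta>)
        = exp (?S ?p ?q - (\<alpha> * ?S p1 q1 + \<beta> * ?S p2 q2))"
      using assms(3-6) pos by (simp add: S powr_def exp_diff exp_add)
    then show ?thesis
      unfolding L using lower upper by simp
  qed
  consider "a > b" | "b > a" | "a = b"
    by linarith
  then show ?thesis
  proof cases
    case 1
    with assms ordered show ?thesis by blast
  next
    case 2
    \<comment> \<open>Since \<open>a > b\<close> abbreviates \<open>b < a\<close>, the first
      variable of \<open>ordered\<close> is the smaller number; the instance is therefore
      \<open>?P b a\<close>, and symmetry of the mean turns it into the goal.\<close>
    with assms ordered[of a b] show ?thesis
      by (simp only: stolarsky_mean_commute[of _ _ a b])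
  next
    case 3
    \<comment> \<open>Here the ratio of means is 1, so only nonnegativity of the exponent remains:
      joint convexity for \<open>ln\<close>, whose derivative is convex.\<close>
    have "convex_on {0<..} (\<lambda>t::real. 1 / t)"
      using convex_on_inverse[of "{0<..}"] by (rule convex_on_eq) (auto simp: inverse_eq_divide)
    then have "?D ?p ?q \<le> \<alpha> * ?D p1 q1 + \<beta> * ?D p2 q2"
      by (intro convex) (auto intro!: derivative_eq_intros)
    moreover have "a powr \<alpha> * a powr \<beta> = a"
      using assms by (simp flip: powr_add)
    ultimately show ?thesis
      unfolding L using 3 assms by (simp add: stolarsky_mean_def)
  qed
qed

end
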